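(* Let $L$ be a nonempty multiset of even integers greater than $2$. If $\epsilon\ge 2(|L|+1)(\max(L)+3)-1$, then there is an $\alpha$-labeling $\Gamma$ of $\left[L\ \middle|\ \epsilon-\sum_{\ell\in L}\ell\right]$ such that $\Delta_p\Gamma\supseteq\mathcal{I}\big(2|L|(\max(L)+3),\,\epsilon\big)$.
   Context: $\mathcal{I}(a,b)=\{x\in\mathbb{Z}\mid a\le x\le b\}$; $|L|$ counts multiplicity. For a multiset $L$ of integers $\ge 2$ and $m\ge 0$, $[L\mid m]$ is the vertex-disjoint union of one $\ell$-cycle for each $\ell\in L$ and a path with $m$ edges; its number of edges is $\epsilon=\sum_{\ell\in L}\ell+m$. A labeling is an isomorphic copy with distinct integer vertices; $\Delta\Gamma$ is the multiset of differences $x-y$ over ordered pairs of adjacent vertices, and $\Delta_p\Gamma$ is the same multiset restricted to edges of the path component. An $\alpha$-labeling of such a bipartite graph with $\epsilon$ edges is a labeling $\Gamma$ with vertex set $\mathcal{I}(0,\epsilon)$ such that every edge joins a vertex of $\mathcal{I}(0,\lfloor(\epsilon-1)/2\rfloor)$ to a vertex of $\mathcal{I}(\lfloor(\epsilon+1)/2\rfloor,\epsilon)$ and $\Delta\Gamma=\pm\mathcal{I}(1,\epsilon)$. *)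

theory Defs
  imports "HOL-Library.Multiset" "Graph_Theory.Pair_Digraph"
begin

text \<open>A finite simple graph is represented by the symmetric, irreflexive arc relation of
  a \<^typ>\<open>'a pair_pre_digraph\<close>: \<^term>\<open>parcs G\<close> is the set of ordered pairs of adjacent
  vertices. The cycles are understood to have length at least 3 (a 2-cycle would be a double edge).\<close>

definition n_edges :: "'a pair_pre_digraph \<Rightarrow> nat" where
  "n_edges G = card ((\<lambda>(x, y). {x, y}) ` parcs G)"

definition cycle_graph :: "nat \<Rightarrow> nat pair_pre_digraph" where
  "cycle_graph l = \<lparr> pverts = {..<l},
     parcs = (\<Union>j<l. {(j, Suc j mod l), (Suc j mod l, j)}) \<rparr>"

definition path_graph :: "nat \<Rightarrow> nat pair_pre_digraph" where
  "path_graph m = \<lparr> pverts = {..m}, parcs = (\<Union>j<m. {(j, Suc j), (Suc j, j)}) \<rparr>"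

definition disjoint_union :: "'a pair_pre_digraph list \<Rightarrow> (nat \<times> 'a) pair_pre_digraph" where
  "disjoint_union Gs = \<lparr> pverts = (\<Union>i<length Gs. Pair i ` pverts (Gs ! i)),
     parcs = (\<Union>i<length Gs. map_prod (Pair i) (Pair i) ` parcs (Gs ! i)) \<rparr>"

text \<open>The graph \<open>[L | m]\<close>. Component 0 is the path.\<close>

definition cycles_path :: "nat multiset \<Rightarrow> nat \<Rightarrow> (nat \<times> nat) pair_pre_digraph" where
  "cycles_path L m =
     disjoint_union (path_graph m # map cycle_graph (sorted_list_of_multiset L))"

definition relabel :: "('a \<Rightarrow> 'b) \<Rightarrow> 'a pair_pre_digraph \<Rightarrow> 'b pair_pre_digraph" where
  "relabel f G = \<lparr> pverts = f ` pverts G, parcs = map_prod f f ` parcs G \<rparr>"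

text \<open>A labeling of \<open>G\<close> is a copy \<^term>\<open>relabel f G\<close> with integer vertices along an injective
  \<open>f\<close>. It is given by \<open>f\<close>, so that components of \<open>G\<close> can be traced in the copy.\<close>

definition labeling :: "'a pair_pre_digraph \<Rightarrow> ('a \<Rightarrow> int) \<Rightarrow> bool" where
  "labeling G f \<longleftrightarrow> inj_on f (pverts G)"

definition differences :: "int pair_pre_digraph \<Rightarrow> int multiset" where
  "differences \<Gamma> = image_mset (\<lambda>(x, y). x - y) (mset_set (parcs \<Gamma>))"

text \<open>The multiset \<open>\<Delta>\<^sub>p\<close> of differences along the path of the labeling of \<open>[L | m]\<close> given by \<open>f\<close>.\<close>

definition path_differences :: "nat \<Rightarrow> (nat \<times> nat \<Rightarrow> int) \<Rightarrow> int multiset" where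
  "path_differences m f = differences (relabel (\<lambda>j. f (0, j)) (path_graph m))"

definition alpha_labeling :: "'a pair_pre_digraph \<Rightarrow> ('a \<Rightarrow> int) \<Rightarrow> bool" where
  "alpha_labeling G f \<longleftrightarrow>
     (let \<epsilon> = int (n_edges G); \<Gamma> = relabel f G;
          A = {0..(\<epsilon> - 1) div 2}; B = {(\<epsilon> + 1) div 2..\<epsilon>}
      in labeling G f \<and> pverts \<Gamma> = {0..\<epsilon>} \<and>
         (\<forall>(x, y) \<in> parcs \<Gamma>. x \<in> A \<and> y \<in> B \<or> x \<in> B \<and> y \<in> A) \<and>
         differences \<Gamma> = mset_set {1..\<epsilon>} + image_mset uminus (mset_set {1..\<epsilon>}))"

end

theory Submission
  imports Defs
begin

text \<open>In an \<open>\<alpha>\<close>-labeling number the two halves of the vertex set from the outside: \<open>x = j\<close> in the lower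
  and \<open>y = \<epsilon> - i\<close> in the upper half, so that an edge has difference \<open>\<epsilon> - (i + j)\<close>. If the outermost \<open>n\<close>
  vertices carry edges with the sums \<open>i + j < n - 1\<close>, and the path ends at depth \<open>c\<close> inside their
  boundary, then continuing at depth \<open>c\<close> beyond the boundary on the other side uses exactly the sum
  \<open>n - 1\<close>. So partial labelings that enter and leave at depth \<open>c\<close> (blocks) can be concatenated.

  Reversing a block changes \<open>c\<close> into \<open>(n - 1) div 2 - c\<close>. By a Euclidean descent with these two operations,
  a block without cycles exists whenever \<open>n \<ge> 2 * c + 1\<close> and \<open>n \<noteq> 4 * c + 1\<close>. An \<open>l\<close>-cycle has an
  explicit block for one particular depth; appending a cycle-free block and reversing moves it to any
  sufficiently large depth \<open>w\<close>. The labeling is a long cycle-free block of depth \<open>w\<close>, which takes the large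
  differences, followed by one block for each cycle.\<close>

section \<open>Centred labelings\<close>

text \<open>Vertices are stored modulo \<open>\<epsilon> + 1\<close>: the lower vertex \<open>j\<close> as \<open>j\<close>, the upper vertex \<open>\<epsilon> - i\<close> as
  \<open>- 1 - i\<close>. Then \<open>gap\<close> is \<open>i + j + 1\<close> on edges, independently of \<open>\<epsilon>\<close>, and concatenation adds new
  vertices at both ends of \<open>{- a..<b}\<close>.\<close>

definition steps :: "'a list \<Rightarrow> ('a \<times> 'a) list" where
  "steps xs = zip xs (tl xs)"

definition gap :: "int \<times> int \<Rightarrow> int" where
  "gap = (\<lambda>(x, y). \<bar>x - y\<bar>)"

definition all_steps :: "'a list \<Rightarrow> 'a list list \<Rightarrow> ('a \<times> 'a) list" where
  "all_steps P Cs = steps P @ concat (map (\<lambda>C. steps (C @ [hd C])) Cs)"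

text \<open>The length condition makes all vertices distinct. There are \<open>a + b - 1\<close>
  steps (\<open>length_all_steps\<close>), so the condition on the image of \<open>gap\<close> makes
  every gap occur exactly once.\<close>

definition centred :: "nat \<Rightarrow> nat \<Rightarrow> int list \<Rightarrow> int list list \<Rightarrow> bool" where
  "centred a b P Cs \<longleftrightarrow> P \<noteq> [] \<and> [] \<notin> set Cs \<and>
     set (concat (P # Cs)) = {- int a..<int b} \<and> length (concat (P # Cs)) = a + b \<and>
     (\<forall>(x, y) \<in> set (all_steps P Cs). x < 0 \<longleftrightarrow> \<not> y < 0) \<and>
     gap ` set (all_steps P Cs) = {1..<int (a + b)}"

section \<open>Consecutive pairs in paths and closed walks\<close>

lemma steps_simps [simp]:
  "steps [] = []" "steps [x] = []" "steps (x # y # zs) = (x, y) # steps (y # zs)"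
  by (simp_all add: steps_def)

lemma length_steps [simp]: "length (steps xs) = length xs - 1"
  by (simp add: steps_def)

lemma steps_append:
  "xs \<noteq> [] \<Longrightarrow> ys \<noteq> [] \<Longrightarrow> steps (xs @ ys) = steps xs @ (last xs, hd ys) # steps ys"
proof (induction xs rule: induct_list012)
  case (2 x)
  then show ?case by (cases ys) simp_all
qed simp_all

lemma steps_Cons: "ys \<noteq> [] \<Longrightarrow> steps (x # ys) = (x, hd ys) # steps ys"
  by (cases ys) simp_all

lemma steps_map: "steps (map f xs) = map (map_prod f f) (steps xs)"
  by (induction xs rule: induct_list012) simp_all

lemma steps_rev: "steps (rev xs) = rev (map prod.swap (steps xs))"
proof (induction xs rule: induct_list012)
  case (3 x y zs)
  have "steps (rev (x # y # zs)) = steps (rev (y # zs) @ [x])"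
    by simp
  also have "\<dots> = steps (rev (y # zs)) @ [(y, x)]"
    by (subst steps_append) auto
  finally show ?case using 3 by simp
qed simp_all

lemma set_steps: "set (steps xs) = {(xs ! j, xs ! Suc j) | j. Suc j < length xs}"
  by (auto simp: steps_def set_zip nth_tl)

lemma set_steps_closed:
  assumes "C \<noteq> []"
  shows "set (steps (C @ [hd C])) = {(C ! j, C ! (Suc j mod length C)) | j. j < length C}"
proof -
  have "(C @ [hd C]) ! Suc j = C ! (Suc j mod length C)" if "j < length C" for j
  proof (cases "Suc j = length C")
    case True
    then show ?thesis using assms by (simp add: nth_append hd_conv_nth)
  next
    case False
    then show ?thesis using that by (simp add: nth_append)
  qed
  moreover have "(C @ [hd C]) ! j = C ! j" if "j < length C" for j
    using that by (simp add: nth_append)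
  ultimately show ?thesis
    unfolding set_steps by (intro Collect_cong) (metis Suc_less_eq length_append_singleton)
qed

lemma steps_closed_map:
  "C \<noteq> [] \<Longrightarrow> steps (map f C @ [hd (map f C)]) = map (map_prod f f) (steps (C @ [hd C]))"
  by (simp add: hd_map flip: steps_map)

lemma all_steps_map:
  "[] \<notin> set Cs \<Longrightarrow> all_steps (map f P) (map (map f) Cs) = map (map_prod f f) (all_steps P Cs)"
proof -
  assume "[] \<notin> set Cs"
  then have "concat (map (\<lambda>C. steps (C @ [hd C])) (map (map f) Cs)) =
      map (map_prod f f) (concat (map (\<lambda>C. steps (C @ [hd C])) Cs))"
    by (induction Cs) (auto simp: steps_closed_map)
  then show ?thesis by (simp add: all_steps_def steps_map)
qed

lemma length_all_steps:
  "P \<noteq> [] \<Longrightarrow> length (all_steps P Cs) = length (concat (P # Cs)) - 1"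
proof -
  assume "P \<noteq> []"
  moreover have "length (concat (map (\<lambda>C. steps (C @ [hd C])) Cs)) = length (concat Cs)"
    by (induction Cs) auto
  ultimately show ?thesis by (cases P) (auto simp: all_steps_def)
qed

lemma centred_rev: "centred a b P Cs \<Longrightarrow> centred a b (rev P) Cs"
proof -
  have "gap ` prod.swap ` S = gap ` S" for S
    by (force simp: gap_def image_image)
  then have "gap ` set (all_steps (rev P) Cs) = gap ` set (all_steps P Cs)"
    by (simp add: all_steps_def steps_rev image_Un)
  moreover have "(\<forall>(x, y) \<in> set (all_steps (rev P) Cs). x < 0 \<longleftrightarrow> \<not> y < 0) \<longleftrightarrow>
      (\<forall>(x, y) \<in> set (all_steps P Cs). x < 0 \<longleftrightarrow> \<not> y < 0)"
    by (auto simp: all_steps_def steps_rev ball_Un)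
  ultimately show "centred a b P Cs \<Longrightarrow> centred a b (rev P) Cs"
    by (auto simp: centred_def)
qed

definition reflect :: "int \<Rightarrow> int" where
  "reflect v = - 1 - v"

text \<open>Reflection exchanges the lower and the upper vertex of equal depth. All gaps survive,
  and only \<open>a\<close> and \<open>b\<close> change roles.\<close>

lemma centred_reflect:
  assumes "centred a b P Cs"
  shows "centred b a (map reflect P) (map (map reflect) Cs)"
proof -
  have verts: "set (concat (map reflect P # map (map reflect) Cs)) = reflect ` set (concat (P # Cs))"
    by (auto simp: image_Un)
  also have "\<dots> = {- int b..<int a}"
  proof -
    have "reflect ` {- int a..<int b} = {- int b..<int a}"
      by (auto simp: reflect_def image_iff intro!: bexI[of _ "- 1 - _"])
    then show ?thesis using assms by (simp add: centred_def)
  qed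
  finally have verts: "set (concat (map reflect P # map (map reflect) Cs)) = {- int b..<int a}" .
  have len: "length (concat (map reflect P # map (map reflect) Cs)) = length (concat (P # Cs))"
    by (simp add: length_concat comp_def)
  have st: "all_steps (map reflect P) (map (map reflect) Cs)
      = map (map_prod reflect reflect) (all_steps P Cs)"
    using assms by (intro all_steps_map) (simp add: centred_def)
  have g: "gap (map_prod reflect reflect p) = gap p" for p
    by (cases p) (auto simp: gap_def reflect_def)
  have "reflect x < 0 \<longleftrightarrow> \<not> x < 0" for x
    by (auto simp: reflect_def)
  then show ?thesis
    using assms verts len unfolding centred_def st
    by (auto simp: image_image g algebra_simps split: prod.splits)
qed

definition expand :: "nat \<Rightarrow> nat \<Rightarrow> int \<Rightarrow> int" where
  "expand a b v = (if v < 0 then v - int a else v + int b)"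

lemma expand_neg_iff [simp]: "expand a b v < 0 \<longleftrightarrow> v < 0"
  by (auto simp: expand_def)

text \<open>Expansion moves the second labeling outside \<open>{- a..<b}\<close>. Its edges join
  negative to nonnegative labels, so each gap grows by exactly \<open>a + b\<close>. The connecting
  edge fills the one value \<open>a + b\<close> left between the two ranges of gaps.\<close>

lemma centred_append:
  assumes "centred a b P Cs" "centred A B P' Cs'"
    and sign: "last P < 0 \<longleftrightarrow> \<not> hd P' < 0"
    and gap: "gap (last P, expand a b (hd P')) = int (a + b)"
  shows "centred (a + A) (b + B) (P @ map (expand a b) P') (Cs @ map (map (expand a b)) Cs')"
proof -
  let ?e = "expand a b"
  have ne: "P \<noteq> []" "P' \<noteq> []" "[] \<notin> set Cs'" and pos: "a + b \<ge> 1" "A + B \<ge> 1"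
    using assms by (auto simp: centred_def neq_Nil_conv)
  have "set (all_steps (P @ map ?e P') (Cs @ map (map ?e) Cs'))
      = insert (last P, ?e (hd P')) (set (all_steps P Cs) \<union> set (all_steps (map ?e P') (map (map ?e) Cs')))"
    using ne by (auto simp: all_steps_def steps_append hd_map)
  also have "\<dots> = insert (last P, ?e (hd P')) (set (all_steps P Cs) \<union> map_prod ?e ?e ` set (all_steps P' Cs'))"
    using ne by (simp add: all_steps_map)
  finally have st: "set (all_steps (P @ map ?e P') (Cs @ map (map ?e) Cs')) = \<dots>" .
  have "gap (map_prod ?e ?e p) = gap p + int (a + b)" if "p \<in> set (all_steps P' Cs')" for p
    using assms(2) that unfolding centred_def by (cases p) (fastforce simp: gap_def expand_def)
  then have "gap ` map_prod ?e ?e ` set (all_steps P' Cs') = (\<lambda>x. x + int (a + b)) ` gap ` set (all_steps P' Cs')"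
    by (simp add: image_image)
  also have "\<dots> = {int (a + b) + 1..<int (a + b + A + B)}"
    using assms(2) by (simp add: centred_def algebra_simps)
  finally have g: "gap ` set (all_steps (P @ map ?e P') (Cs @ map (map ?e) Cs')) =
      insert (int (a + b)) ({1..<int (a + b)} \<union> {int (a + b) + 1..<int (a + b + A + B)})"
    using assms(1) unfolding st by (simp add: image_Un gap centred_def del: of_nat_add)
  also have "\<dots> = {1..<int (a + A + (b + B))}"
    using pos by auto
  finally have g: "gap ` set (all_steps (P @ map ?e P') (Cs @ map (map ?e) Cs')) = \<dots>" .
  have "?e ` {- int A..<int B} = {- int (a + A)..<- int a} \<union> {int b..<int (b + B)}"
  proof (intro set_eqI iffI)
    fix x assume "x \<in> {- int (a + A)..<- int a} \<union> {int b..<int (b + B)}"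
    then have "x = ?e (if x < 0 then x + int a else x - int b)"
      "(if x < 0 then x + int a else x - int b) \<in> {- int A..<int B}"
      by (auto simp: expand_def)
    then show "x \<in> ?e ` {- int A..<int B}" by blast
  qed (auto simp: expand_def)
  then have "?e ` set (concat (P' # Cs')) = {- int (a + A)..<- int a} \<union> {int b..<int (b + B)}"
    using assms(2) by (simp add: centred_def)
  moreover have "set (concat ((P @ map ?e P') # (Cs @ map (map ?e) Cs')))
      = set (concat (P # Cs)) \<union> ?e ` set (concat (P' # Cs'))"
    by auto
  ultimately have "set (concat ((P @ map ?e P') # (Cs @ map (map ?e) Cs')))
      = {- int a..<int b} \<union> ({- int (a + A)..<- int a} \<union> {int b..<int (b + B)})"
    using assms(1) by (simp add: centred_def)
  also have "\<dots> = {- int (a + A)..<int (b + B)}"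
    by auto
  finally have v: "set (concat ((P @ map ?e P') # (Cs @ map (map ?e) Cs'))) = \<dots>" .
  have len: "length (concat ((P @ map ?e P') # (Cs @ map (map ?e) Cs'))) = a + A + (b + B)"
    using assms(1,2) by (simp add: centred_def length_concat comp_def)
  have bip: "\<forall>(x, y) \<in> set (all_steps (P @ map ?e P') (Cs @ map (map ?e) Cs')). x < 0 \<longleftrightarrow> \<not> y < 0"
    using assms(1,2) sign unfolding st centred_def by fastforce
  show ?thesis
    using assms(1,2) v len bip g unfolding centred_def by auto
qed

text \<open>The depth is measured by the label \<open>- 1 - c\<close> at the start, and from the nearer end of
  \<open>{- a..<b}\<close> at the end of the path, whose label is nonnegative iff \<open>n\<close> is even.\<close>

definition block :: "nat \<Rightarrow> nat \<Rightarrow> int list \<Rightarrow> int list list \<Rightarrow> bool" where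
  "block c n P Cs \<longleftrightarrow> centred ((n + 1) div 2) (n div 2) P Cs \<and> hd P = - 1 - int c \<and>
     last P = (if even n then int (n div 2) - 1 - int c else int c - int ((n + 1) div 2))"

lemma block_bound:
  assumes "block c n P Cs"
  shows "c < (n + 1) div 2"
proof -
  have "hd P \<in> set (concat (P # Cs))"
    using assms by (cases P) (auto simp: block_def centred_def)
  also have "\<dots> = {- int ((n + 1) div 2)..<int (n div 2)}"
    using assms by (simp add: block_def centred_def)
  finally show ?thesis using assms by (simp add: block_def)
qed

text \<open>The connecting edge joins two vertices of depth \<open>c\<close> on either side of the
  old boundary, so its gap is \<open>n\<close>. For odd \<open>n\<close> the first path ends at a
  negative label, and the second block has to be reflected so that it starts on the nonnegative
  side. \<open>P\<close> stays a prefix of the new path.\<close>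

lemma block_append:
  assumes "block c n P Cs" "block c m P' Cs'"
  shows "\<exists>Q Ds. block c (n + m) (P @ Q) (Cs @ Ds) \<and> map length Ds = map length Cs'"
proof -
  let ?e = "expand ((n + 1) div 2) (n div 2)"
  have ne: "P \<noteq> []" "P' \<noteq> []" using assms by (auto simp: block_def centred_def)
  note bounds = block_bound[OF assms(1)] block_bound[OF assms(2)]
  show ?thesis
  proof (cases "even n")
    case True
    then obtain k where k: "n = 2 * k" by blast
    have "centred ((n + 1) div 2 + (m + 1) div 2) (n div 2 + m div 2)
        (P @ map ?e P') (Cs @ map (map ?e) Cs')"
      using assms bounds
      by (intro centred_append) (auto simp: block_def k gap_def expand_def)
    moreover have "last (map ?e P') = ?e (last P')" using ne by (simp add: last_map)
    ultimately have "block c (n + m) (P @ map ?e P') (Cs @ map (map ?e) Cs')"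
      using assms ne bounds
      by (cases "even m") (auto simp: block_def k expand_def elim!: evenE oddE)
    moreover have "map length (map (map ?e) Cs') = map length Cs'" by simp
    ultimately show ?thesis by blast
  next
    case False
    then obtain k where k: "n = 2 * k + 1" by (blast elim: oddE)
    let ?Q = "map ?e (map reflect P')" and ?D = "map (map ?e) (map (map reflect) Cs')"
    have "hd (map reflect P') = int c" "last ?Q = ?e (reflect (last P'))"
      using assms ne by (auto simp: block_def hd_map last_map reflect_def)
    moreover have "centred ((n + 1) div 2 + m div 2) (n div 2 + (m + 1) div 2) (P @ ?Q) (Cs @ ?D)"
      using assms bounds calculation
      by (intro centred_append centred_reflect) (auto simp: block_def k gap_def expand_def)
    ultimately have "block c (n + m) (P @ ?Q) (Cs @ ?D)"
      using assms ne bounds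
      by (cases "even m") (auto simp: block_def k expand_def reflect_def elim!: evenE oddE)
    moreover have "map length ?D = map length Cs'" by simp
    ultimately show ?thesis by blast
  qed
qed

text \<open>The reversed path starts where the old one ended. For even \<open>n\<close> that label
  is nonnegative, so a reflection is needed as well; for odd \<open>n\<close> reversal alone
  suffices.\<close>

lemma block_transpose:
  assumes "block c n P Cs"
  shows "\<exists>Q Ds. block ((n - 1) div 2 - c) n Q Ds \<and> map length Ds = map length Cs"
proof -
  have ne: "P \<noteq> []" using assms by (auto simp: block_def centred_def)
  note bound = block_bound[OF assms]
  show ?thesis
  proof (cases "even n")
    case True
    then obtain k where k: "n = 2 * k" by blast
    have "centred ((n + 1) div 2) (n div 2) (rev (map reflect P)) (map (map reflect) Cs)"
      using assms centred_rev[OF centred_reflect] by (fastforce simp: block_def k)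
    then have "block ((n - 1) div 2 - c) n (rev (map reflect P)) (map (map reflect) Cs)"
      using assms ne bound
      by (auto simp: block_def k hd_rev last_rev hd_map last_map reflect_def of_nat_diff)
    moreover have "map length (map (map reflect) Cs) = map length Cs" by simp
    ultimately show ?thesis by blast
  next
    case False
    then obtain k where k: "n = 2 * k + 1" by (blast elim: oddE)
    have "block ((n - 1) div 2 - c) n (rev P) Cs"
      using assms ne bound centred_rev
      by (auto simp: block_def k hd_rev last_rev of_nat_diff)
    then show ?thesis by blast
  qed
qed

section \<open>Cycle-free blocks\<close>

lemma block_path_zero: "n > 0 \<Longrightarrow> \<exists>P. block 0 n P []"
proof (induction n)
  case (Suc n)
  have one: "block 0 1 [- 1] []"
    by (auto simp: block_def centred_def all_steps_def)
  show ?case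
  proof (cases "n = 0")
    case True
    then show ?thesis using one by auto
  next
    case False
    then obtain P where "block 0 n P []" using Suc by auto
    from block_append[OF this one] show ?thesis by auto
  qed
qed simp

text \<open>For \<open>n = 4 * c + 1\<close> the prescribed first and last labels coincide, which is
  impossible on a path with more than one vertex; this is the exceptional size.\<close>

lemma block_path:
  assumes "n \<ge> 2 * c + 1" "c = 0 \<or> n \<noteq> 4 * c + 1"
  shows "\<exists>P. block c n P []"
  using assms
proof (induction n arbitrary: c rule: less_induct)
  case (less n)
  \<comment> \<open>These are the sizes for which reversal turns depth 0 into depth
    \<open>c\<close>.\<close>
  have base: "\<exists>P. block c m P []" if "m = 2 * c + 1 \<or> m = 2 * c + 2" for c m
  proof -
    have "m > 0" using that by auto
    then obtain P where "block 0 m P []" using block_path_zero by blast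
    from block_transpose[OF this] show ?thesis using that by auto
  qed
  have large: "\<exists>P. block c n P []" if c: "n \<ge> 4 * c + 2" for c
  proof (cases "c = 0")
    case True
    then show ?thesis using block_path_zero c by auto
  next
    case False
    \<comment> \<open>A block of size \<open>2 * c + 1\<close> is split off, except when this would
      leave the forbidden size \<open>4 * c + 1\<close>; then one vertex more is taken and
      \<open>4 * c\<close> remain.\<close>
    define m where "m = (if n = 6 * c + 2 then 2 * c + 2 else 2 * c + 1)"
    have "m = 2 * c + 1 \<or> m = 2 * c + 2" by (simp add: m_def)
    then obtain P where P: "block c m P []" using base by blast
    have "\<exists>P. block c (n - m) P []"
      using c False by (intro less.IH) (auto simp: m_def)
    then obtain P' where "block c (n - m) P' []" by blast
    from block_append[OF P this] show ?thesis using c by (auto simp: m_def split: if_splits)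
  qed
  consider "c = 0" | "n \<ge> 4 * c + 2" | "n \<le> 4 * c" using less.prems by linarith
  then show ?case
  proof cases
    case 1
    then show ?thesis using block_path_zero less.prems by auto
  next
    case 2
    then show ?thesis by (rule large)
  next
    case 3
    \<comment> \<open>Reversal leads to a depth so small relative to \<open>n\<close> that the case
      \<open>large\<close> applies.\<close>
    let ?c = "(n - 1) div 2 - c"
    have h: "2 * ((n - 1) div 2) \<le> n - 1" "c \<le> (n - 1) div 2" using less.prems(1) by auto
    then have "n \<ge> 4 * ?c + 2" using 3 less.prems(1) by linarith
    from large[OF this] obtain P where "block ?c n P []" by blast
    moreover have "(n - 1) div 2 - ?c = c" using h by simp
    ultimately show ?thesis using block_transpose[of ?c n P "[]"] by auto
  qed
qed

section \<open>Blocks containing one cycle\<close>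

text \<open>The path alternates between the halves and moves outwards in both, so its gaps are the
  consecutive integers from \<open>p + q + 1\<close> on. The cores below are assembled from such
  pieces.\<close>

fun zigzag :: "int \<Rightarrow> int \<Rightarrow> nat \<Rightarrow> int list" where
  "zigzag p q 0 = []"
| "zigzag p q (Suc m) = (- 1 - p) # q # zigzag (p + 1) (q + 1) m"

lemma length_zigzag [simp]: "length (zigzag p q m) = 2 * m"
  by (induction m arbitrary: p q) auto

lemma zigzag_eq_Nil [simp]: "zigzag p q m = [] \<longleftrightarrow> m = 0"
  by (cases m) auto

lemma hd_zigzag [simp]: "m > 0 \<Longrightarrow> hd (zigzag p q m) = - 1 - p"
  by (cases m) auto

lemma last_zigzag [simp]: "m > 0 \<Longrightarrow> last (zigzag p q m) = q + int m - 1"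
proof (induction m arbitrary: p q)
  case (Suc m)
  then show ?case by (cases "m = 0") auto
qed simp

lemma set_zigzag: "set (zigzag p q m) = {- int m - p..<- p} \<union> {q..<q + int m}"
proof (induction m arbitrary: p q)
  case (Suc m)
  then show ?case by auto
qed simp

lemma steps_zigzag:
  assumes "p \<ge> 0" "q \<ge> 0" "m > 0"
  shows "gap ` set (steps (zigzag p q m)) = {p + q + 1..<p + q + 2 * int m}"
    and "(x, y) \<in> set (steps (zigzag p q m)) \<Longrightarrow> x < 0 \<and> y \<ge> 0 \<or> x \<ge> 0 \<and> y < 0"
proof -
  have "gap ` set (steps (zigzag p q m)) = {p + q + 1..<p + q + 2 * int m} \<and>
      (\<forall>(x, y) \<in> set (steps (zigzag p q m)). x < 0 \<and> y \<ge> 0 \<or> x \<ge> 0 \<and> y < 0)"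
    using assms
  proof (induction m arbitrary: p q)
    case (Suc m)
    show ?case
    proof (cases m)
      case 0
      then show ?thesis using Suc.prems by (auto simp: gap_def)
    next
      case (Suc m')
      let ?z = "zigzag (p + 1) (q + 1) m"
      have "steps (zigzag p q (Suc m)) = (- 1 - p, q) # (q, - 2 - p) # steps ?z"
        using Suc by simp
      moreover have "gap ` set (steps ?z) = {p + q + 3..<p + q + 2 + 2 * int m}"
        "\<forall>(x, y) \<in> set (steps ?z). x < 0 \<and> y \<ge> 0 \<or> x \<ge> 0 \<and> y < 0"
        using Suc.IH[of "p + 1" "q + 1"] Suc.prems Suc by (auto simp: algebra_simps)
      moreover have "gap (- 1 - p, q) = p + q + 1" "gap (q, - 2 - p) = p + q + 2"
        using Suc.prems by (auto simp: gap_def)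
      ultimately have "gap ` set (steps (zigzag p q (Suc m)))
          = {p + q + 1, p + q + 2} \<union> {p + q + 3..<p + q + 2 + 2 * int m}"
        by auto
      also have "\<dots> = {p + q + 1..<p + q + 2 * int (Suc m)}"
        using Suc by auto
      finally show ?thesis
        using \<open>steps (zigzag p q (Suc m)) = _\<close> Suc.prems
          \<open>\<forall>(x, y) \<in> set (steps ?z). x < 0 \<and> y \<ge> 0 \<or> x \<ge> 0 \<and> y < 0\<close>
        by auto
    qed
  qed simp
  then show "gap ` set (steps (zigzag p q m)) = {p + q + 1..<p + q + 2 * int m}"
    and "(x, y) \<in> set (steps (zigzag p q m)) \<Longrightarrow> x < 0 \<and> y \<ge> 0 \<or> x \<ge> 0 \<and> y < 0"
    by auto
qed

lemma gap_steps_rev: "gap ` set (steps (rev xs)) = gap ` set (steps xs)"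
  by (force simp: steps_rev gap_def image_image)

text \<open>The path is a single vertex, which is possible because \<open>4 * j + 1\<close> is the
  size where both path ends coincide. The cycle consists of two zigzags that avoid this vertex; they
  use the gaps below \<open>2 * j\<close> and above \<open>2 * j + 1\<close>, and the two edges
  joining them supply \<open>2 * j + 1\<close> and \<open>2 * j\<close>.\<close>

lemma core_even:
  assumes "j > 0"
  shows "\<exists>P C. block j (4 * j + 1) P [C] \<and> length C = 4 * j"
proof -
  let ?C = "zigzag 0 0 j @ zigzag (int j + 1) (int j) j"
  have st: "set (all_steps [- 1 - int j] [?C]) = set (steps (zigzag 0 0 j)) \<union>
      {(int j - 1, - 2 - int j), (2 * int j - 1, - 1)} \<union> set (steps (zigzag (int j + 1) (int j) j))"
    using assms by (auto simp: all_steps_def steps_append hd_append)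
  have "gap ` {(int j - 1, - 2 - int j), (2 * int j - 1, - 1)} = {2 * int j + 1, 2 * int j}"
    using assms by (auto simp: gap_def)
  then have "gap ` set (all_steps [- 1 - int j] [?C]) =
      {1..<2 * int j} \<union> {2 * int j + 1, 2 * int j} \<union> {2 * int j + 2..<4 * int j + 1}"
    unfolding st image_Un using assms by (simp add: steps_zigzag algebra_simps)
  also have "\<dots> = {1..<4 * int j + 1}"
    using assms by auto
  finally have g: "gap ` set (all_steps [- 1 - int j] [?C]) = \<dots>" .
  have bip: "\<forall>(x, y) \<in> set (all_steps [- 1 - int j] [?C]). x < 0 \<longleftrightarrow> \<not> y < 0"
    unfolding st using assms by (auto dest: steps_zigzag(2)[rotated -1])
  have v: "set (concat [[- 1 - int j], ?C]) = {- (2 * int j + 1)..<2 * int j}"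
    using assms by (auto simp: set_zigzag)
  have "block j (4 * j + 1) [- 1 - int j] [?C]"
    using assms g bip v by (auto simp: block_def centred_def add.commute)
  then show ?thesis by fastforce
qed

text \<open>Three zigzags lie at increasing distance from the centre: \<open>?A\<close> and
  \<open>?B\<close> belong to the cycle, and the path lies between them. The two further cycle
  vertices \<open>- 1 - ?J\<close> and \<open>2 * ?J\<close> connect \<open>?A\<close> with
  \<open>?B\<close>; their four edges supply the gaps missing between the three ranges.\<close>

lemma core_odd:
  assumes "j > 0"
  shows "\<exists>P C. block (j + 1) (6 * j + 2) P [C] \<and> length C = 4 * j + 2"
proof -
  let ?J = "int j"
  let ?P = "zigzag (?J + 1) ?J j" and ?A = "zigzag 0 0 j" and ?B = "zigzag (2 * ?J + 1) (2 * ?J + 1) j"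
  let ?C = "?A @ [- 1 - ?J] @ rev ?B @ [2 * ?J]"
  have st: "set (all_steps ?P [?C]) = set (steps ?P) \<union> set (steps ?A) \<union> set (steps (rev ?B)) \<union>
      {(?J - 1, - 1 - ?J), (- 1 - ?J, 3 * ?J), (- 2 - 2 * ?J, 2 * ?J), (2 * ?J, - 1)}"
    using assms by (auto simp: all_steps_def steps_append steps_Cons hd_append hd_rev last_rev)
  have "gap ` {(?J - 1, - 1 - ?J), (- 1 - ?J, 3 * ?J), (- 2 - 2 * ?J, 2 * ?J), (2 * ?J, - 1)}
      = {2 * ?J, 4 * ?J + 1, 4 * ?J + 2, 2 * ?J + 1}"
    using assms by (auto simp: gap_def)
  then have "gap ` set (all_steps ?P [?C]) = {2 * ?J + 2..<4 * ?J + 1} \<union> {1..<2 * ?J} \<union>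
      {4 * ?J + 3..<6 * ?J + 2} \<union> {2 * ?J, 4 * ?J + 1, 4 * ?J + 2, 2 * ?J + 1}"
    unfolding st image_Un using assms by (simp add: steps_zigzag gap_steps_rev algebra_simps)
  also have "\<dots> = {1..<6 * ?J + 2}"
    using assms by auto
  finally have g: "gap ` set (all_steps ?P [?C]) = \<dots>" .
  have bip: "\<forall>(x, y) \<in> set (all_steps ?P [?C]). x < 0 \<longleftrightarrow> \<not> y < 0"
    unfolding st using assms by (auto simp: steps_rev dest: steps_zigzag(2)[rotated -1])
  have v: "set (concat [?P, ?C]) = {- (3 * ?J + 1)..<3 * ?J + 1}"
    using assms by (auto simp: set_zigzag)
  have "block (j + 1) (6 * j + 2) ?P [?C]"
    using assms g bip v by (auto simp: block_def centred_def add.commute)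
  then show ?thesis by fastforce
qed

text \<open>Appending a cycle-free block keeps the depth \<open>c\<close> and enlarges the size; the
  reversal then gives a depth determined by that size. Hence \<open>m\<close> can be chosen to reach
  \<open>w\<close>. Its evenness avoids the exceptional size \<open>4 * c + 1\<close>.\<close>

lemma block_shift:
  assumes core: "block c n P [C]" and m: "even m" "m > 2 * c" and w: "2 * (w + c) + (if even n then 2 else 1) = n + m"
  shows "\<exists>P C'. block w (n + m) P [C'] \<and> length C' = length C"
proof -
  have "m \<noteq> 4 * c + 1" using m(1) by auto
  then obtain P' where "block c m P' []"
    using block_path[of c m] m by auto
  from block_append[OF core this] obtain Q where "block c (n + m) Q [C]"
    by auto
  from block_transpose[OF this] obtain Q' Ds
    where "block ((n + m - 1) div 2 - c) (n + m) Q' Ds" "map length Ds = [length C]"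
    by auto
  moreover have "(n + m - 1) div 2 - c = w"
    using w m(1) by (auto split: if_splits)
  ultimately show ?thesis by auto
qed

text \<open>This is the total size that the equation in \<open>block_shift\<close> forces for the
  cores \<open>core_even\<close> and \<open>core_odd\<close>.\<close>

definition block_size :: "nat \<Rightarrow> nat \<Rightarrow> nat" where
  "block_size w l = 2 * w + l div 2 + (if 4 dvd l then 1 else 3)"

text \<open>The bound on \<open>w\<close> provides \<open>m > 2 * c\<close> in
  \<open>block_shift\<close>. For \<open>l = 4 * j + 2\<close> it says exactly
  \<open>w > 3 * j\<close>, which is what is needed there; for \<open>l = 4 * j\<close> already
  \<open>w > 2 * j\<close> would do.\<close>

lemma block_cycle:
  assumes "even l" "l > 2" "w \<ge> 3 * (l div 2) div 2"
  shows "\<exists>P C. block w (block_size w l) P [C] \<and> length C = l"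
proof (cases "4 dvd l")
  case True
  then obtain j where j: "l = 4 * j" by blast
  then obtain P C where C: "block j (4 * j + 1) P [C]" "length C = 4 * j"
    using core_even[of j] assms by auto
  have "\<exists>P C'. block w (4 * j + 1 + (2 * w - 2 * j)) P [C'] \<and> length C' = length C"
    using assms by (intro block_shift[OF C(1)]) (auto simp: j)
  then show ?thesis using assms C by (simp add: block_size_def j ac_simps)
next
  case False
  then have "l mod 4 = 2" using assms(1) by presburger
  then obtain j where j: "l = 4 * j + 2" by (metis mult_div_mod_eq)
  then obtain P C where C: "block (j + 1) (6 * j + 2) P [C]" "length C = 4 * j + 2"
    using core_odd[of j] assms by auto
  have "\<exists>P C'. block w (6 * j + 2 + (2 * w + 2 - 4 * j)) P [C'] \<and> length C' = length C"
    using assms by (intro block_shift[OF C(1)]) (auto simp: j)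
  moreover have "6 * j + 2 + (2 * w + 2 - 4 * j) = block_size w l"
    using assms False by (auto simp: block_size_def j)
  ultimately show ?thesis using C j by auto
qed

text \<open>All blocks share the depth \<open>w\<close>, so they can be appended one by one. The
  conclusion keeps \<open>P\<close> as a prefix, so that its gaps remain on the path.\<close>

lemma block_cycles:
  assumes "\<And>l. l \<in> set ls \<Longrightarrow> even l \<and> l > 2 \<and> w \<ge> 3 * (l div 2) div 2" "block w r P Cs"
  shows "\<exists>Q Ds. block w (r + sum_list (map (block_size w) ls)) (P @ Q) (Cs @ Ds) \<and> map length Ds = ls"
  using assms
proof (induction ls arbitrary: r P Cs)
  case Nil
  then show ?case by (intro exI[of _ "[]"]) simp
next
  case (Cons l ls)
  obtain P' C where C: "block w (block_size w l) P' [C]" "length C = l"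
    using block_cycle Cons.prems(1) by (metis list.set_intros(1))
  from block_append[OF Cons.prems(2) C(1)] obtain Q C'
    where Q: "block w (r + block_size w l) (P @ Q) (Cs @ [C'])" "length C' = l"
    using C by auto
  obtain Q' Ds where "block w (r + block_size w l + sum_list (map (block_size w) ls)) ((P @ Q) @ Q')
      ((Cs @ [C']) @ Ds)" "map length Ds = ls"
    using Cons.IH[OF _ Q(1)] Cons.prems(1) by (metis list.set_intros(2))
  then show ?case using Q by (intro exI[of _ "Q @ Q'"] exI[of _ "C' # Ds"]) (simp add: add.assoc)
qed

section \<open>From centred labelings to \<open>\<alpha>\<close>-labelings\<close>

text \<open>\<open>D\<close> contains the edges in an arbitrary orientation. At most
  \<open>n\<close> arcs realise \<open>n\<close> gaps, so each gap comes from one arc. Orienting all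
  arcs downwards gives the positive differences, and swapping gives the negative ones.\<close>

lemma differences_symmetric:
  assumes D: "finite D" "card D \<le> n" "gap ` D = {1..int n}" and arcs: "parcs G = D \<union> prod.swap ` D"
  shows "differences G = mset_set {1..int n} + image_mset uminus (mset_set {1..int n})"
proof -
  let ?d = "\<lambda>(x, y). x - y :: int"
  define U where "U = {(x, y) \<in> parcs G. x > y}"
  have ne: "x \<noteq> y" if "(x, y) \<in> D" for x y
  proof
    assume "x = y"
    then have "0 \<in> gap ` D" using that by (force simp: gap_def)
    then show False using D by simp
  qed
  have U: "U = (\<lambda>(x, y). (max x y, min x y)) ` D"
  proof (intro set_eqI iffI)
    fix p assume "p \<in> U"
    then show "p \<in> (\<lambda>(x, y). (max x y, min x y)) ` D"
      by (cases p) (force simp: U_def arcs)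
  next
    fix p assume "p \<in> (\<lambda>(x, y). (max x y, min x y)) ` D"
    then show "p \<in> U"
      using ne by (fastforce simp: U_def arcs max_def min_def)
  qed
  have fin: "finite U" and card: "card U \<le> n"
    using D card_image_le[OF D(1), of "\<lambda>(x, y). (max x y, min x y)"] by (auto simp: U)
  have "?d ` U = gap ` D"
    unfolding U image_image by (intro image_cong) (auto simp: gap_def)
  then have im: "?d ` U = {1..int n}" using D by simp
  then have "card (?d ` U) = n" by simp
  then have "inj_on ?d U"
    using card fin by (metis card_image_le eq_card_imp_inj_on le_antisym)
  then have 1: "image_mset ?d (mset_set U) = mset_set {1..int n}"
    by (simp add: image_mset_mset_set im)
  have "parcs G = U \<union> prod.swap ` U"
  proof (intro set_eqI iffI)
    fix p assume "p \<in> parcs G"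
    then show "p \<in> U \<union> prod.swap ` U"
      using ne by (cases p) (force simp: U_def arcs image_iff)
  qed (auto simp: U_def arcs)
  moreover have "U \<inter> prod.swap ` U = {}" by (auto simp: U_def)
  ultimately have "differences G = image_mset ?d (mset_set U) + image_mset ?d (mset_set (prod.swap ` U))"
    using fin by (simp add: differences_def mset_set_Union)
  also have "mset_set (prod.swap ` U) = image_mset prod.swap (mset_set U)"
    by (simp add: image_mset_mset_set)
  also have "image_mset ?d \<dots> = image_mset uminus (image_mset ?d (mset_set U))"
    by (simp add: multiset.map_comp comp_def case_prod_unfold)
  finally show ?thesis by (simp add: 1)
qed

text \<open>The gap depends only on the unordered pair, as its maximum minus its minimum. Since
  \<open>gap\<close> is injective on \<open>D\<close> by counting, distinct arcs of \<open>D\<close>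
  are distinct edges.\<close>

lemma n_edges_symmetric:
  assumes D: "finite D" "card D \<le> n" "gap ` D = {1..int n}"
    and arcs: "map_prod f f ` parcs G = D \<union> prod.swap ` D"
    and V: "parcs G \<subseteq> pverts G \<times> pverts G" "inj_on f (pverts G)"
  shows "n_edges G = n"
proof -
  let ?u = "\<lambda>(x, y). {x, y}"
  have "card (gap ` D) = n" using D(3) by simp
  then have card: "card D = n"
    using card_image_le[OF D(1), of gap] D(2) by simp
  then have inj: "inj_on gap D"
    using D(1) \<open>card (gap ` D) = n\<close> by (simp add: eq_card_imp_inj_on)
  have "gap = (\<lambda>e. Max e - Min e) \<circ> ?u"
    by (simp add: gap_def fun_eq_iff max_def min_def)
  then have "inj_on ((\<lambda>e. Max e - Min e) \<circ> ?u) D"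
    using inj by (simp only:)
  then have "inj_on ?u D"
    by (rule inj_on_imageI2)
  then have "card (?u ` D) = n"
    by (simp add: card_image card)
  also have "?u ` D = ?u ` (D \<union> prod.swap ` D)"
  proof -
    have "?u ` prod.swap ` D = ?u ` D"
      unfolding image_image by (intro image_cong) auto
    then show ?thesis by (simp add: image_Un)
  qed
  also have "\<dots> = image f ` ?u ` parcs G"
    unfolding arcs[symmetric] image_image by (intro image_cong) auto
  also have "card \<dots> = card (?u ` parcs G)"
    using V by (intro card_image inj_on_subset[OF inj_on_image_Pow[OF V(2)]]) auto
  finally show ?thesis by (simp add: n_edges_def)
qed

lemma mset_set_image_subseteq:
  assumes "finite S" "A \<subseteq> f ` S"
  shows "mset_set A \<subseteq># image_mset f (mset_set S)"
proof -
  obtain T where T: "T \<subseteq> S" "inj_on f T" "A = f ` T"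
    using assms(2) by (auto simp: subset_image_inj)
  then have "mset_set A = image_mset f (mset_set T)"
    by (simp add: image_mset_mset_set)
  also have "\<dots> \<subseteq># image_mset f (mset_set S)"
    using T assms(1) by (intro image_mset_subseteq_mono subset_imp_msubset_mset_set)
  finally show ?thesis .
qed

section \<open>Images of the components under a labeling\<close>

lemma image_disjoint_union_Cons:
  assumes F: "\<And>j. f (0, j) = F P j" "\<And>i j. i < length Cs \<Longrightarrow> f (Suc i, j) = F (Cs ! i) j"
  shows "f ` pverts (disjoint_union (H # map g Cs)) = F P ` pverts H \<union> (\<Union>C\<in>set Cs. F C ` pverts (g C))"
    and "map_prod f f ` parcs (disjoint_union (H # map g Cs)) =
      map_prod (F P) (F P) ` parcs H \<union> (\<Union>C\<in>set Cs. map_prod (F C) (F C) ` parcs (g C))"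
proof -
  have "f ` pverts (disjoint_union (H # map g Cs)) = F P ` pverts H \<union> (\<Union>i<length Cs. F (Cs ! i) ` pverts (g (Cs ! i)))"
    by (simp add: disjoint_union_def lessThan_Suc_eq_insert_0 image_Un image_UN image_image F)
  also have "(\<Union>i<length Cs. F (Cs ! i) ` pverts (g (Cs ! i))) = (\<Union>C\<in>set Cs. F C ` pverts (g C))"
    by (force simp: in_set_conv_nth)
  finally show "f ` pverts (disjoint_union (H # map g Cs)) = F P ` pverts H \<union> (\<Union>C\<in>set Cs. F C ` pverts (g C))" .
  have "map_prod f f ` parcs (disjoint_union (H # map g Cs)) = map_prod (F P) (F P) ` parcs H \<union>
      (\<Union>i<length Cs. map_prod (F (Cs ! i)) (F (Cs ! i)) ` parcs (g (Cs ! i)))"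
    by (simp add: disjoint_union_def lessThan_Suc_eq_insert_0 image_Un image_UN image_image
        map_prod_def case_prod_unfold F)
  also have "(\<Union>i<length Cs. map_prod (F (Cs ! i)) (F (Cs ! i)) ` parcs (g (Cs ! i))) =
      (\<Union>C\<in>set Cs. map_prod (F C) (F C) ` parcs (g C))"
    by (force simp: in_set_conv_nth)
  finally show "map_prod f f ` parcs (disjoint_union (H # map g Cs)) =
      map_prod (F P) (F P) ` parcs H \<union> (\<Union>C\<in>set Cs. map_prod (F C) (F C) ` parcs (g C))" .
qed

lemma path_graph_image:
  assumes "P \<noteq> []"
  shows "(\<lambda>j. h (P ! j)) ` pverts (path_graph (length P - 1)) = h ` set P"
    and "map_prod (\<lambda>j. h (P ! j)) (\<lambda>j. h (P ! j)) ` parcs (path_graph (length P - 1)) =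
      map_prod h h ` (set (steps P) \<union> prod.swap ` set (steps P))"
proof -
  have "{..length P - 1} = {..<length P}" using assms by (cases P) auto
  then have "set P = (!) P ` {..length P - 1}"
    by (auto simp: set_conv_nth)
  then show "(\<lambda>j. h (P ! j)) ` pverts (path_graph (length P - 1)) = h ` set P"
    by (simp add: path_graph_def image_image)
  have "set (steps P) = (\<lambda>j. (P ! j, P ! Suc j)) ` {..<length P - 1}"
    by (auto simp: set_steps)
  then show "map_prod (\<lambda>j. h (P ! j)) (\<lambda>j. h (P ! j)) ` parcs (path_graph (length P - 1)) =
      map_prod h h ` (set (steps P) \<union> prod.swap ` set (steps P))"
    by (auto simp: path_graph_def image_Un image_UN image_image)
qed

lemma cycle_graph_image:
  assumes "C \<noteq> []"
  shows "(\<lambda>j. h (C ! j)) ` pverts (cycle_graph (length C)) = h ` set C"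
    and "map_prod (\<lambda>j. h (C ! j)) (\<lambda>j. h (C ! j)) ` parcs (cycle_graph (length C)) =
      map_prod h h ` (set (steps (C @ [hd C])) \<union> prod.swap ` set (steps (C @ [hd C])))"
proof -
  have "set C = (!) C ` {..<length C}"
    by (auto simp: set_conv_nth)
  then show "(\<lambda>j. h (C ! j)) ` pverts (cycle_graph (length C)) = h ` set C"
    by (simp add: cycle_graph_def image_image)
  have "set (steps (C @ [hd C])) = (\<lambda>j. (C ! j, C ! (Suc j mod length C))) ` {..<length C}"
    using assms by (auto simp: set_steps_closed)
  then show "map_prod (\<lambda>j. h (C ! j)) (\<lambda>j. h (C ! j)) ` parcs (cycle_graph (length C)) =
      map_prod h h ` (set (steps (C @ [hd C])) \<union> prod.swap ` set (steps (C @ [hd C])))"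
    by (auto simp: cycle_graph_def image_Un image_UN image_image)
qed

lemma parcs_cycles_path_subset:
  "parcs (cycles_path L m) \<subseteq> pverts (cycles_path L m) \<times> pverts (cycles_path L m)"
proof -
  let ?Gs = "path_graph m # map cycle_graph (sorted_list_of_multiset L)"
  have "parcs G \<subseteq> pverts G \<times> pverts G" if "G \<in> set ?Gs" for G
    using that by (auto simp: path_graph_def cycle_graph_def)
  then have sub: "parcs (?Gs ! i) \<subseteq> pverts (?Gs ! i) \<times> pverts (?Gs ! i)" if "i < length ?Gs" for i
    using that nth_mem by blast
  show ?thesis
  proof
    fix p assume "p \<in> parcs (cycles_path L m)"
    then obtain i q where "i < length ?Gs" "q \<in> parcs (?Gs ! i)" "p = map_prod (Pair i) (Pair i) q"
      unfolding cycles_path_def disjoint_union_def by auto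
    then show "p \<in> pverts (cycles_path L m) \<times> pverts (cycles_path L m)"
      using sub unfolding cycles_path_def disjoint_union_def by (cases q) fastforce
  qed
qed

lemma all_steps_in_set:
  assumes "(x, y) \<in> set (all_steps P Cs)" "[] \<notin> set Cs"
  shows "x \<in> set (concat (P # Cs))" "y \<in> set (concat (P # Cs))"
proof -
  have "x \<in> set xs \<and> y \<in> set xs" if "(x, y) \<in> set (steps xs)" for xs :: "'a list"
    using that by (auto simp: steps_def dest: set_zip_leftD set_zip_rightD intro: list.set_sel(2))
  then have *: "x \<in> set P \<and> y \<in> set P \<or> (\<exists>C\<in>set Cs. x \<in> set (C @ [hd C]) \<and> y \<in> set (C @ [hd C]))"
    using assms(1) by (fastforce simp: all_steps_def)
  have "set (C @ [hd C]) = set C" if "C \<in> set Cs" for C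
    using assms(2) that by (cases C) auto
  then show "x \<in> set (concat (P # Cs))" "y \<in> set (concat (P # Cs))"
    using * by auto
qed

text \<open>A gap \<open>g\<close> becomes the difference \<open>\<epsilon> + 1 - g\<close>, so the
  smallest gaps on the path turn into the largest path differences. The sign of a stored label tells
  the half of the vertex set, which gives the bipartition.\<close>

lemma alpha_labeling_if_centred:
  fixes \<epsilon> :: nat
  assumes c: "centred ((\<epsilon> + 2) div 2) ((\<epsilon> + 1) div 2) P Cs" and L: "map length Cs = sorted_list_of_multiset L"
    and r: "{1..<int r} \<subseteq> gap ` set (steps P)" and "\<epsilon> > 0"
  shows "\<exists>f. alpha_labeling (cycles_path L (\<epsilon> - sum_mset L)) f \<and>
    mset_set {int \<epsilon> + 2 - int r..int \<epsilon>} \<subseteq># path_differences (\<epsilon> - sum_mset L) f"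
proof -
  \<comment> \<open>This undoes the storage modulo \<open>\<epsilon> + 1\<close>.\<close>
  define lab where "lab v = (if v < 0 then v + int \<epsilon> + 1 else v)" for v
  define f where "f = (\<lambda>(i, j). lab ((P # Cs) ! i ! j))"
  let ?S = "set (all_steps P Cs)" and ?G = "cycles_path L (\<epsilon> - sum_mset L)"
  let ?D = "map_prod lab lab ` ?S"
  have ne: "P \<noteq> []" "[] \<notin> set Cs" using c by (auto simp: centred_def)
  have len: "length (concat (P # Cs)) = \<epsilon> + 1" using c by (simp add: centred_def)
  have "sum_mset L = sum_list (sorted_list_of_multiset L)"
    by (metis mset_sorted_list_of_multiset sum_mset_sum_list)
  also have "\<dots> = length (concat Cs)" by (simp add: L[symmetric] length_concat)
  finally have m: "\<epsilon> - sum_mset L = length P - 1" using len by simp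
  have G: "?G = disjoint_union (path_graph (length P - 1) # map (\<lambda>C. cycle_graph (length C)) Cs)"
    unfolding cycles_path_def m L[symmetric] by (simp add: comp_def)
  have f: "f (0, j) = lab (P ! j)" "i < length Cs \<Longrightarrow> f (Suc i, j) = lab (Cs ! i ! j)" for i j
    by (simp_all add: f_def)
  have "lab ` {- int ((\<epsilon> + 2) div 2)..<int ((\<epsilon> + 1) div 2)} = {0..int \<epsilon>}"
  proof (intro set_eqI iffI)
    fix x assume x: "x \<in> {0..int \<epsilon>}"
    let ?y = "if x < int ((\<epsilon> + 1) div 2) then x else x - int \<epsilon> - 1"
    have "x = lab ?y" "?y \<in> {- int ((\<epsilon> + 2) div 2)..<int ((\<epsilon> + 1) div 2)}"
      using x by (auto simp: lab_def)
    then show "x \<in> lab ` {- int ((\<epsilon> + 2) div 2)..<int ((\<epsilon> + 1) div 2)}" by blast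
  qed (auto simp: lab_def)
  then have verts: "lab ` set (concat (P # Cs)) = {0..int \<epsilon>}"
    using c by (simp add: centred_def)
  have "f ` pverts ?G = lab ` set P \<union> (\<Union>C\<in>set Cs. lab ` set C)"
  proof -
    have "f ` pverts ?G = (\<lambda>j. lab (P ! j)) ` pverts (path_graph (length P - 1)) \<union>
        (\<Union>C\<in>set Cs. (\<lambda>j. lab (C ! j)) ` pverts (cycle_graph (length C)))"
      unfolding G by (rule image_disjoint_union_Cons) (simp_all add: f)
    also have "\<dots> = lab ` set P \<union> (\<Union>C\<in>set Cs. lab ` set C)"
      using ne by (intro arg_cong2[where f = "(\<union>)"] SUP_cong path_graph_image cycle_graph_image) auto
    finally show ?thesis .
  qed
  also have "\<dots> = {0..int \<epsilon>}"
    unfolding verts[symmetric] by auto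
  finally have pverts: "f ` pverts ?G = {0..int \<epsilon>}" .
  have "map_prod f f ` parcs ?G = map_prod lab lab ` (?S \<union> prod.swap ` ?S)"
  proof -
    let ?c = "\<lambda>C. set (steps (C @ [hd C]))"
    have "map_prod f f ` parcs ?G =
        map_prod (\<lambda>j. lab (P ! j)) (\<lambda>j. lab (P ! j)) ` parcs (path_graph (length P - 1)) \<union>
        (\<Union>C\<in>set Cs. map_prod (\<lambda>j. lab (C ! j)) (\<lambda>j. lab (C ! j)) ` parcs (cycle_graph (length C)))"
      unfolding G by (rule image_disjoint_union_Cons) (simp_all add: f)
    also have "\<dots> = map_prod lab lab ` (set (steps P) \<union> prod.swap ` set (steps P)) \<union>
        (\<Union>C\<in>set Cs. map_prod lab lab ` (?c C \<union> prod.swap ` ?c C))"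
      using ne by (intro arg_cong2[where f = "(\<union>)"] SUP_cong path_graph_image cycle_graph_image) auto
    also have "\<dots> = map_prod lab lab ` (?S \<union> prod.swap ` ?S)"
      by (simp add: all_steps_def image_Un image_UN UN_Un_distrib Un_ac)
    finally show ?thesis .
  qed
  then have parcs: "map_prod f f ` parcs ?G = ?D \<union> prod.swap ` ?D"
    by (simp add: image_Un image_image map_prod_def case_prod_unfold)
  have range: "x \<in> {- int ((\<epsilon> + 2) div 2)..<int ((\<epsilon> + 1) div 2)}" "y \<in> {- int ((\<epsilon> + 2) div 2)..<int ((\<epsilon> + 1) div 2)}"
    if "(x, y) \<in> ?S" for x y
  proof -
    have "set (concat (P # Cs)) = {- int ((\<epsilon> + 2) div 2)..<int ((\<epsilon> + 1) div 2)}"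
      using c by (simp only: centred_def)
    then show "x \<in> {- int ((\<epsilon> + 2) div 2)..<int ((\<epsilon> + 1) div 2)}"
      "y \<in> {- int ((\<epsilon> + 2) div 2)..<int ((\<epsilon> + 1) div 2)}"
      using all_steps_in_set[OF that ne(2)] by blast+
  qed
  have bip: "x < 0 \<longleftrightarrow> \<not> y < 0" if "(x, y) \<in> ?S" for x y
    using c that by (auto simp: centred_def)
  have gap: "gap (map_prod lab lab p) = int \<epsilon> + 1 - gap p" if "p \<in> ?S" for p
  proof -
    obtain x y where p: "p = (x, y)" by fastforce
    show ?thesis
      using that bip[of x y] range[of x y] unfolding p by (auto simp: gap_def lab_def)
  qed
  have flip: "(\<lambda>x. int \<epsilon> + 1 - x) ` {a..<b} = {int \<epsilon> + 2 - b..int \<epsilon> + 1 - a}" for a b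
    by (force simp: image_iff intro: bexI[of _ "int \<epsilon> + 1 - _"])
  have "gap ` ?D = (\<lambda>x. int \<epsilon> + 1 - x) ` gap ` ?S"
    by (simp add: image_image gap)
  also have "gap ` ?S = {1..<int \<epsilon> + 1}"
  proof -
    have "(\<epsilon> + 2) div 2 + (\<epsilon> + 1) div 2 = \<epsilon> + 1" by presburger
    then have "int ((\<epsilon> + 2) div 2 + (\<epsilon> + 1) div 2) = int \<epsilon> + 1" by simp
    then show ?thesis using c unfolding centred_def by (simp only:)
  qed
  finally have gapD: "gap ` ?D = {1..int \<epsilon>}" by (auto simp: flip)
  have D: "finite ?D" "card ?D \<le> \<epsilon>"
  proof -
    have "card ?D \<le> card ?S" by (intro card_image_le) simp
    also have "\<dots> \<le> length (all_steps P Cs)" by (rule card_length)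
    finally show "card ?D \<le> \<epsilon>" using len ne by (simp add: length_all_steps)
  qed simp
  \<comment> \<open>The graph has as many vertices as the concatenated lists have entries, namely
    \<open>\<epsilon> + 1\<close>, and \<open>f\<close> maps them onto \<open>\<epsilon> + 1\<close>
    labels.\<close>
  have inj: "inj_on f (pverts ?G)"
  proof (rule eq_card_imp_inj_on)
    have "pverts ((path_graph (length P - 1) # map (\<lambda>C. cycle_graph (length C)) Cs) ! i)
        = {..<length ((P # Cs) ! i)}" if "i < length (P # Cs)" for i
      using that ne by (cases i; cases P) (auto simp: path_graph_def cycle_graph_def)
    then have "pverts ?G = (\<Union>i<length (P # Cs). Pair i ` {..<length ((P # Cs) ! i)})"
      unfolding G disjoint_union_def by simp
    also have "\<dots> = Sigma {..<length (P # Cs)} (\<lambda>i. {..<length ((P # Cs) ! i)})"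
      by auto
    finally have V: "pverts ?G = \<dots>" .
    then show "finite (pverts ?G)" by simp
    have "card (pverts ?G) = (\<Sum>i<length (P # Cs). length ((P # Cs) ! i))"
      unfolding V by (subst card_SigmaI) auto
    also have "\<dots> = length (concat (P # Cs))"
      unfolding length_concat sum_list_sum_nth length_map by (intro sum.cong) (auto simp: nth_Cons')
    finally show "card (f ` pverts ?G) = card (pverts ?G)"
      using len pverts by simp
  qed
  have n: "n_edges ?G = \<epsilon>"
    by (rule n_edges_symmetric[OF D gapD parcs parcs_cycles_path_subset inj])
  have "alpha_labeling ?G f"
    unfolding alpha_labeling_def Let_def n labeling_def
  proof (intro conjI ballI, goal_cases)
    case 1
    show ?case by (rule inj)
  next
    case 2
    show ?case using pverts by (simp add: relabel_def)
  next
    case (3 p)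
    then have "p \<in> ?D \<union> prod.swap ` ?D" using parcs by (simp add: relabel_def)
    then obtain x y where xy: "(x, y) \<in> ?S" "p = (lab x, lab y) \<or> p = (lab y, lab x)"
      by auto
    show ?case
      using bip[OF xy(1)] range[OF xy(1)] xy(2) by (auto simp: lab_def)
  next
    case 4
    show ?case by (rule differences_symmetric[OF D gapD]) (simp add: relabel_def parcs)
  qed
  moreover have "mset_set {int \<epsilon> + 2 - int r..int \<epsilon>} \<subseteq># path_differences (\<epsilon> - sum_mset L) f"
    unfolding path_differences_def differences_def
  proof (rule mset_set_image_subseteq)
    let ?H = "relabel (\<lambda>j. f (0, j)) (path_graph (\<epsilon> - sum_mset L))"
    have H: "parcs ?H = map_prod lab lab ` (set (steps P) \<union> prod.swap ` set (steps P))"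
      unfolding relabel_def m using path_graph_image(2)[OF ne(1), of lab] by (simp add: f)
    then show "finite (parcs ?H)" by simp
    show "{int \<epsilon> + 2 - int r..int \<epsilon>} \<subseteq> (\<lambda>(x, y). x - y) ` parcs ?H"
    proof
      fix d assume "d \<in> {int \<epsilon> + 2 - int r..int \<epsilon>}"
      then have "int \<epsilon> + 1 - d \<in> {1..<int r}" by auto
      then have "int \<epsilon> + 1 - d \<in> gap ` set (steps P)" using r by blast
      then obtain x y where xy: "(x, y) \<in> set (steps P)" "gap (x, y) = int \<epsilon> + 1 - d"
        by force
      then have "gap (lab x, lab y) = d"
        using gap[of "(x, y)"] by (simp add: all_steps_def)
      moreover have "(lab x, lab y) \<in> parcs ?H" "(lab y, lab x) \<in> parcs ?H"
        using xy(1) unfolding H by force+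
      moreover have "lab x - lab y = d \<or> lab y - lab x = d"
        using calculation(1) by (auto simp: gap_def)
      ultimately show "d \<in> (\<lambda>(x, y). x - y) ` parcs ?H"
        by (metis (mono_tags, lifting) case_prod_conv image_eqI)
    qed
  qed
  ultimately show ?thesis by blast
qed

section \<open>Choice of the depth and of the initial path block\<close>

theorem theorem4p8:
  fixes L :: "nat multiset" and \<epsilon> :: nat
  assumes "L \<noteq> {#}"
    and "\<And>l. l \<in># L \<Longrightarrow> even l \<and> l > 2"
    and "\<epsilon> \<ge> 2 * (size L + 1) * (Max (set_mset L) + 3) - 1"
  shows "\<exists>f. alpha_labeling (cycles_path L (\<epsilon> - sum_mset L)) f \<and>
    mset_set {int (2 * size L * (Max (set_mset L) + 3))..int \<epsilon>}
      \<subseteq># path_differences (\<epsilon> - sum_mset L) f"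
proof -
  define M where "M = Max (set_mset L)"
  define ls where "ls = sorted_list_of_multiset L"
  define s where "s w = sum_list (map (block_size w) ls)" for w
  have ls: "mset ls = L" by (simp add: ls_def)
  have mem: "even l" "l > 2" "l \<le> M" if "l \<in> set ls" for l
    using assms(2)[of l] that by (auto simp: M_def ls_def)
  have len: "length ls = size L" using ls by (metis size_mset)
  have "M \<in># L" using assms(1) by (simp add: M_def)
  then have M: "even M" "M > 2" using assms(2) by auto
  obtain K where K: "M = 2 * K" using M by blast
  \<comment> \<open>The bound per cycle is one less than \<open>2 * (M + 3) = 4 * K + 6\<close>,
    even for the larger of the two candidate depths.\<close>
  have s_bound: "s w \<le> size L * (4 * K + 5)" if "w \<le> 3 * K div 2 + 1" for w
  proof -
    have "block_size w l \<le> 4 * K + 5" if "l \<in> set ls" for l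
      using mem[OF that] \<open>w \<le> _\<close> by (auto simp: block_size_def K)
    then have "s w \<le> sum_list (map (\<lambda>_. 4 * K + 5) ls)"
      unfolding s_def by (intro sum_list_mono)
    then show ?thesis by (simp add: len sum_list_triv)
  qed
  have s_Suc: "s (w + 1) = s w + 2 * size L" for w
  proof -
    have "s (w + 1) = (\<Sum>l\<leftarrow>ls. block_size w l + 2)"
      unfolding s_def by (intro arg_cong[where f = sum_list] map_cong) (simp_all add: block_size_def)
    also have "\<dots> = s w + 2 * size L"
      by (subst sum_list_addf) (simp add: s_def sum_list_triv len)
    finally show ?thesis .
  qed
  have size: "size L > 0" using assms(1) by (simp add: nonempty_has_size)
  \<comment> \<open>Two candidate depths suffice to avoid the exceptional size \<open>4 * w + 1\<close> in \<open>block_path\<close>.\<close>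
  define w0 where "w0 = 3 * K div 2"
  define w where "w = (if \<epsilon> + 1 - s w0 = 4 * w0 + 1 then w0 + 1 else w0)"
  define r where "r = \<epsilon> + 1 - s w"
  have eps: "\<epsilon> + 1 \<ge> size L * (4 * K + 6) + (4 * K + 6)"
    using assms(3) by (simp add: M_def[symmetric] K algebra_simps)
  have w: "w0 \<le> w" "w \<le> w0 + 1" by (auto simp: w_def)
  have s0: "s w0 \<le> size L * (4 * K + 5)" "s w \<le> size L * (4 * K + 5)"
    using s_bound w by (auto simp: w0_def)
  \<comment> \<open>Raising the depth from \<open>w0\<close> to \<open>w0 + 1\<close> decreases the
    size left for the path block by \<open>2 * size L\<close> and increases the forbidden value by
    4, so equality cannot occur at both depths.\<close>
  have r: "r + s w = \<epsilon> + 1" "r \<ge> 4 * K + 6" "r \<noteq> 4 * w + 1"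
    using s0 eps s_Suc[of w0] size by (auto simp: r_def w_def algebra_simps split: if_splits)
  have "r \<ge> 2 * w + 1" using r w by (auto simp: w0_def)
  then obtain P where P: "block w r P []" using block_path r by blast
  have "even l \<and> l > 2 \<and> w \<ge> 3 * (l div 2) div 2" if "l \<in> set ls" for l
    using mem[OF that] w by (auto simp: w0_def K div_le_mono)
  from block_cycles[of ls, OF this P] obtain Q Cs
    where B: "block w (\<epsilon> + 1) (P @ Q) Cs" "map length Cs = ls"
    using r by (auto simp: s_def)
  have "{1..<int r} = gap ` set (steps P)"
    using P by (auto simp: block_def centred_def all_steps_def)
  also have "set (steps P) \<subseteq> set (steps (P @ Q))"
    using P by (cases "Q = []") (auto simp: steps_append block_def centred_def)
  finally have "{1..<int r} \<subseteq> gap ` set (steps (P @ Q))" by blast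
  then obtain f where f: "alpha_labeling (cycles_path L (\<epsilon> - sum_mset L)) f"
    "mset_set {int \<epsilon> + 2 - int r..int \<epsilon>} \<subseteq># path_differences (\<epsilon> - sum_mset L) f"
    using alpha_labeling_if_centred[of \<epsilon> "P @ Q" Cs L r] B eps by (auto simp: block_def ls_def)
  \<comment> \<open>The slack of one per cycle in \<open>s0\<close> absorbs the additional 1, as
    there is at least one cycle.\<close>
  have "\<epsilon> + 2 \<le> size L * (4 * K + 6) + r"
    using r s0 size by (auto simp: algebra_simps)
  then have "int \<epsilon> + 2 - int r \<le> int (size L * (4 * K + 6))" by linarith
  also have "size L * (4 * K + 6) = 2 * size L * (M + 3)" by (simp add: K algebra_simps)
  finally have "mset_set {int (2 * size L * (M + 3))..int \<epsilon>} \<subseteq># mset_set {int \<epsilon> + 2 - int r..int \<epsilon>}"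
    by (intro subset_imp_msubset_mset_set) auto
  then show ?thesis using f unfolding M_def by (meson subset_mset.trans)
qed

end
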